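(* Let $\Bbbk$ be an algebraically closed field of characteristic zero, let $V$ be a $\Bbbk$-vector space of dimension $d=2$, and let $A$ be a commutative, $r$-spanning subspace of $\mathrm{End}_{\Bbbk}(V)$ for $r=1$ or $r=2$. Then the maximal possible dimension of $A$ is $2$, and if $\dim(A)=2$, then $A$ is equivalent, up to a change of basis of $V$, to one of the following spaces of matrices: (1) the diagonal $2\times2$ matrices; (2) $\langle\mathrm{Id}\rangle\oplus W_{1,1}$, that is, the upper triangular $2\times 2$ matrices with the same element on the diagonal.
   Context: A subspace $A\subset\mathrm{End}_{\Bbbk}(V)$ is commutative if its elements commute pairwise. It is $r$-spanning if there is a subspace $U\subset V$ of dimension at most $r$ such that $A\cdot U=V$, where $A\cdot U$ is the linear span of $\{a(u):a\in A,u\in U\}$. $W_{1,1}$ is the space of $2\times2$ matrices whose only possibly nonzero entry is in the first row and last column. *)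

theory Defs
  imports
    "HOL-Analysis.Cartesian_Space"
    "HOL-Computational_Algebra.Polynomial"
    "HOL-Library.Function_Algebras"
begin

text \<open>A vector space is given by its scalar multiplication \<open>sc\<close>, subject to
  \<^locale>\<open>vector_space\<close>. Endomorphisms live in the function space \<^typ>\<open>'v \<Rightarrow> 'v\<close>, whose
  addition is the pointwise one of \<^theory>\<open>HOL-Library.Function_Algebras\<close>.\<close>

definition fun_scale :: "('k::field \<Rightarrow> 'v::ab_group_add \<Rightarrow> 'v) \<Rightarrow> 'k \<Rightarrow> ('v \<Rightarrow> 'v) \<Rightarrow> ('v \<Rightarrow> 'v)"
  where "fun_scale sc c f = (\<lambda>v. sc c (f v))"

lemma vector_space_fun_scale:
  assumes "vector_space sc"
  shows "vector_space (fun_scale sc)"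
proof -
  interpret V: vector_space sc by (rule assms)
  show ?thesis
    by unfold_locales
      (auto simp: fun_scale_def fun_eq_iff V.scale_right_distrib V.scale_left_distrib)
qed

definition End :: "('k::field \<Rightarrow> 'v::ab_group_add \<Rightarrow> 'v) \<Rightarrow> ('v \<Rightarrow> 'v) set"
  where "End sc = {f. Vector_Spaces.linear sc sc f}"

definition End_subspace :: "('k::field \<Rightarrow> 'v::ab_group_add \<Rightarrow> 'v) \<Rightarrow> ('v \<Rightarrow> 'v) set \<Rightarrow> bool"
  where "End_subspace sc A \<longleftrightarrow> A \<subseteq> End sc \<and> module.subspace (fun_scale sc) A"

text \<open>As \<^const>\<open>vector_space.dim\<close> is \<open>0\<close> on infinite-dimensional subspaces, \<open>End_dim\<close> and
  \<open>spanning\<close> are the intended notions only over a finite-dimensional space.\<close>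

definition End_dim :: "('k::field \<Rightarrow> 'v::ab_group_add \<Rightarrow> 'v) \<Rightarrow> ('v \<Rightarrow> 'v) set \<Rightarrow> nat"
  where "End_dim sc A = vector_space.dim (fun_scale sc) A"

definition commutative :: "('v \<Rightarrow> 'v) set \<Rightarrow> bool"
  where "commutative A \<longleftrightarrow> (\<forall>f\<in>A. \<forall>g\<in>A. f \<circ> g = g \<circ> f)"

definition spanning :: "('k::field \<Rightarrow> 'v::ab_group_add \<Rightarrow> 'v) \<Rightarrow> nat \<Rightarrow> ('v \<Rightarrow> 'v) set \<Rightarrow> bool"
  where "spanning sc r A \<longleftrightarrow>
    (\<exists>U. module.subspace sc U \<and> vector_space.dim sc U \<le> r \<and>
         module.span sc {f u | f u. f \<in> A \<and> u \<in> U} = UNIV)"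

definition ordered_basis :: "('k::field \<Rightarrow> 'v::ab_group_add \<Rightarrow> 'v) \<Rightarrow> ('n \<Rightarrow> 'v) \<Rightarrow> bool"
  where "ordered_basis sc b \<longleftrightarrow>
    inj b \<and> \<not> module.dependent sc (range b) \<and> module.span sc (range b) = UNIV"

definition matrix_of ::
    "('k::field \<Rightarrow> 'v::ab_group_add \<Rightarrow> 'v) \<Rightarrow> ('n::finite \<Rightarrow> 'v) \<Rightarrow> ('v \<Rightarrow> 'v) \<Rightarrow> 'k^'n^'n"
  where "matrix_of sc b f = (\<chi> i j. module.representation sc (range b) (f (b j)) (b i))"

definition equivalent_to ::
    "('k::field \<Rightarrow> 'v::ab_group_add \<Rightarrow> 'v) \<Rightarrow> ('v \<Rightarrow> 'v) set \<Rightarrow> ('k^'n::finite^'n) set \<Rightarrow> bool"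
  where "equivalent_to sc A M \<longleftrightarrow> (\<exists>b. ordered_basis sc b \<and> matrix_of sc b ` A = M)"

definition diagonal_matrices :: "('k::field^2^2) set"
  where "diagonal_matrices = {M. \<forall>i j. i \<noteq> j \<longrightarrow> M $ i $ j = 0}"

text \<open>In the index type \<^typ>\<open>2\<close>, \<open>1\<close> is the first index and \<open>2\<close> (which equals \<open>0\<close>) the
  last one, as usual in HOL-Analysis.\<close>

definition W_1_1 :: "('k::field^2^2) set"
  where "W_1_1 = {M. \<forall>i j. (i, j) \<noteq> (1, 2) \<longrightarrow> M $ i $ j = 0}"

definition Id_plus_W_1_1 :: "('k::field^2^2) set"
  where "Id_plus_W_1_1 = {mat c + N | c N. N \<in> W_1_1}"

lemma Id_W_1_1_direct: "range mat \<inter> (W_1_1 :: ('k::field^2^2) set) = {0}"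
proof (intro set_eqI iffI)
  fix M :: "'k^2^2" assume "M \<in> range mat \<inter> W_1_1"
  then obtain c where c: "M = mat c" "M \<in> W_1_1" by blast
  then have "M $ 1 $ 1 = 0" by (simp add: W_1_1_def)
  then have "c = 0" using c by (simp add: mat_def)
  then show "M \<in> {0}" using c by (simp add: mat_def vec_eq_iff)
next
  fix M :: "'k^2^2" assume "M \<in> {0}"
  moreover have "(0 :: 'k^2^2) \<in> range mat"
    by (rule range_eqI[of _ _ 0]) (simp add: mat_def vec_eq_iff)
  ultimately show "M \<in> range mat \<inter> W_1_1" by (auto simp: W_1_1_def)
qed

lemma Id_plus_W_1_1_eq:
  "Id_plus_W_1_1 = {M :: 'k::field^2^2. M $ 2 $ 1 = 0 \<and> M $ 1 $ 1 = M $ 2 $ 2}"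
proof (intro set_eqI iffI)
  fix M :: "'k^2^2" assume "M \<in> Id_plus_W_1_1"
  then show "M \<in> {M. M $ 2 $ 1 = 0 \<and> M $ 1 $ 1 = M $ 2 $ 2}"
    by (auto simp: Id_plus_W_1_1_def W_1_1_def mat_def)
next
  fix M :: "'k^2^2" assume M: "M \<in> {M. M $ 2 $ 1 = 0 \<and> M $ 1 $ 1 = M $ 2 $ 2}"
  define N where "N = M - mat (M $ 1 $ 1)"
  have N0: "N $ 1 $ 1 = 0" "N $ 2 $ 1 = 0" "N $ 2 $ 2 = 0"
    using M by (simp_all add: N_def mat_def)
  have "N $ i $ j = 0" if "(i, j) \<noteq> (1, 2)" for i j
    using exhaust_2[of i] exhaust_2[of j] N0 that by (elim disjE) simp_all
  then have "N \<in> W_1_1"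
    unfolding W_1_1_def by blast
  moreover have "M = mat (M $ 1 $ 1) + N"
    by (simp add: N_def)
  ultimately show "M \<in> Id_plus_W_1_1"
    unfolding Id_plus_W_1_1_def by blast
qed

end

theory Submission
  imports Defs
begin

text \<open>A nonscalar endomorphism \<open>f\<close> of a plane has a cyclic vector, so everything commuting with
  \<open>f\<close> is of the form \<open>x + y f\<close>; hence \<open>A\<close> has dimension at most \<open>2\<close>, and equals \<open>\<langle>Id, f\<rangle>\<close>
  when its dimension is \<open>2\<close>. Splitting the characteristic polynomial of \<open>f\<close>, either \<open>f\<close> has two
  distinct eigenvalues and \<open>A\<close> is diagonal in an eigenbasis, or \<open>f\<close> is a Jordan block.\<close>

no_notation vector_scalar_mult (infixl "*s" 70)

section \<open>Spans, dimension and independence of pairs in a general vector space\<close>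

context vector_space
begin

text \<open>By Steinitz exchange, an independent subset of \<open>span T\<close> has at most
  \<open>card T\<close> elements. A basis of \<open>S\<close> already has that many, so no element
  of \<open>T\<close> can lie outside its span. This later turns an inclusion into an equality by
  counting.\<close>

lemma subspace_eq_span_if_card_le_dim:
  assumes S: "subspace S" "S \<subseteq> span T" and T: "finite T" "card T \<le> dim S"
  shows "S = span T"
proof -
  obtain B where B: "B \<subseteq> S" "independent B" "S \<subseteq> span B" "card B = dim S"
    using basis_exists by blast
  have fin: "finite B"
    using independent_span_bound[OF T(1) B(2)] B(1) S(2) by blast
  have "x \<in> span B" if "x \<in> T" for x
  proof (rule ccontr)
    assume x: "x \<notin> span B"
    then have "independent (insert x B)" using B(2) by (rule independent_insertI)
    moreover have "insert x B \<subseteq> span T" using B(1) S(2) that span_base by blast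
    ultimately have "card (insert x B) \<le> card T"
      using independent_span_bound[OF T(1)] by blast
    moreover have "x \<notin> B" using x span_base by blast
    ultimately show False using fin B(4) T(2) by simp
  qed
  then have "span T \<subseteq> span B" by (intro span_minimal) auto
  moreover have "span B \<subseteq> S" using B(1) S(1) by (intro span_minimal)
  ultimately show ?thesis using S(2) by blast
qed

lemma span_pair: "span {a, b} = {x *s a + y *s b | x y. True}"
proof (intro set_eqI iffI)
  fix v assume "v \<in> span {a, b}"
  then obtain x y where "v - x *s a = y *s b"
    by (auto simp: span_breakdown_eq)
  then have "v = x *s a + y *s b"
    by (simp add: diff_eq_eq add.commute)
  then show "v \<in> {x *s a + y *s b | x y. True}" by blast
next
  fix v assume "v \<in> {x *s a + y *s b | x y. True}"
  then show "v \<in> span {a, b}"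
    by (auto intro: span_add span_scale span_base)
qed

text \<open>The condition \<open>a \<noteq> b\<close> belongs on the left because
  \<open>{a, a}\<close> collapses to a singleton, which can be independent although the relation
  with coefficients \<open>1\<close> and \<open>- 1\<close> is nontrivial.\<close>

lemma independent_pair_iff:
  "a \<noteq> b \<and> independent {a, b} \<longleftrightarrow> (\<forall>x y. x *s a + y *s b = 0 \<longrightarrow> x = 0 \<and> y = 0)"
  (is "?L \<longleftrightarrow> ?R")
proof
  assume L: ?L
  then have b: "b \<noteq> 0" and a: "a \<notin> span {b}"
    by (auto simp: independent_insert)
  show ?R
  proof (intro allI impI)
    fix x y assume e: "x *s a + y *s b = 0"
    have "x = 0"
    proof (rule ccontr)
      assume x: "x \<noteq> 0"
      have "inverse x *s (x *s a + y *s b) = 0" using e by simp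
      then have "a + (inverse x * y) *s b = 0"
        using x by (simp add: scale_right_distrib)
      then have "a = (- (inverse x * y)) *s b"
        by (simp add: add_eq_0_iff2)
      then show False using a by (metis insertI1 span_base span_scale)
    qed
    then show "x = 0 \<and> y = 0" using e b by simp
  qed
next
  assume R: ?R
  have "b \<noteq> 0" using R[rule_format, of 0 1] by auto
  moreover have "a \<notin> span {b}"
  proof
    assume "a \<in> span {b}"
    then obtain k where "a = k *s b" by (auto simp: span_singleton)
    then show False using R[rule_format, of 1 "- k"] by simp
  qed
  moreover have "a \<noteq> b" using R[rule_format, of 1 "- 1"] by auto
  ultimately show ?L by (auto simp: independent_insert)
qed

end

section \<open>Endomorphisms that are combinations of \<open>id\<close> and \<open>f\<close>\<close>

context vector_space
begin

interpretation E: vector_space "fun_scale scale"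
  by (rule vector_space_fun_scale) unfold_locales

lemma mem_span_id_iff:
  "g \<in> E.span {id, f} \<longleftrightarrow> (\<exists>x y. g = (\<lambda>v. x *s v + y *s f v))"
  by (auto simp: E.span_pair fun_scale_def plus_fun_def)

lemma linear_combination_id:
  assumes "Vector_Spaces.linear scale scale f"
  shows "Vector_Spaces.linear scale scale (\<lambda>v. x *s v + y *s f v)"
proof -
  interpret f: Vector_Spaces.linear scale scale f by (rule assms)
  show ?thesis
    by unfold_locales (simp_all add: f.add f.scale algebra_simps)
qed

end

section \<open>Planes: bases, cyclic vectors, commutants and existence\<close>

locale plane = vector_space +
  assumes dim_UNIV: "dim UNIV = 2"
begin

lemma span_independent_pair:
  assumes "a \<noteq> b" "independent {a, b}"
  shows "span {a, b} = UNIV"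
proof -
  obtain B where B: "B \<subseteq> UNIV" "UNIV \<subseteq> span B" "card B = 2"
    using basis_exists[of UNIV] dim_UNIV by metis
  have "dim (span {a, b}) = 2"
    using assms dim_span_eq_card_independent by simp
  \<comment> \<open>Since \<open>card B = 2\<close> is positive, \<open>B\<close> is finite; thus
    \<open>dim UNIV = 2\<close> also encodes finite dimension.\<close>
  then have "span {a, b} = span B"
    using B by (intro subspace_eq_span_if_card_le_dim) (auto intro: card_ge_0_finite)
  then show ?thesis using B by auto
qed

lemma obtain_basis_pair:
  obtains a b where "a \<noteq> b" "independent {a, b}" "span {a, b} = UNIV"
proof -
  obtain B where B: "independent B" "card B = 2"
    using basis_exists[of UNIV] dim_UNIV by metis
  then obtain a b where "B = {a, b}" "a \<noteq> b" by (auto simp: card_2_iff)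
  then show ?thesis using B that span_independent_pair by metis
qed

text \<open>Without a cyclic vector every vector is an eigenvector. Comparing the eigenvalues at
  \<open>a\<close>, \<open>b\<close> and \<open>a + b\<close> for a basis \<open>a\<close>,
  \<open>b\<close> makes them all equal, so \<open>f\<close> would be scalar.\<close>

lemma cyclic_vector_if_nonscalar:
  assumes "Vector_Spaces.linear scale scale f" and ns: "\<nexists>c. f = scale c"
  obtains v where "v \<noteq> f v" "independent {v, f v}"
proof -
  interpret f: Vector_Spaces.linear scale scale f by (rule assms(1))
  have False if dep: "\<forall>v. \<not> (v \<noteq> f v \<and> independent {v, f v})"
  proof -
    have eig: "\<exists>c. f v = c *s v" for v
    proof (cases "v = 0")
      case False
      obtain x y where xy: "x *s v + y *s f v = 0" "x \<noteq> 0 \<or> y \<noteq> 0"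
        using dep independent_pair_iff by blast
      then have y: "y \<noteq> 0" using False by auto
      have "inverse y *s (x *s v + y *s f v) = 0" using xy by simp
      then have "(inverse y * x) *s v + f v = 0"
        using y by (simp add: scale_right_distrib)
      then have "f v = (- (inverse y * x)) *s v"
        by (simp add: add_eq_0_iff)
      then show ?thesis by blast
    qed (simp add: f.zero)
    obtain a b where ab: "a \<noteq> b" "independent {a, b}" "span {a, b} = UNIV"
      using obtain_basis_pair by blast
    obtain p q r where pqr: "f a = p *s a" "f b = q *s b" "f (a + b) = r *s (a + b)"
      using eig by metis
    then have "(p - r) *s a + (q - r) *s b = 0"
      by (simp add: f.add algebra_simps)
    then have "p - r = 0 \<and> q - r = 0"
      using ab independent_pair_iff[of a b] by blast
    then have "p = r" "q = r" by simp_all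
    then have "f v = r *s v" for v
    proof -
      obtain x y where "v = x *s a + y *s b" using ab(3) span_pair by blast
      then show ?thesis using pqr \<open>p = r\<close> \<open>q = r\<close>
        by (simp add: f.add f.scale scale_right_distrib mult.commute)
    qed
    then show False using ns by blast
  qed
  then show ?thesis using that by blast
qed

text \<open>An endomorphism commuting with \<open>f\<close> is determined by its value at a cyclic
  vector \<open>v\<close>. The coordinates of \<open>g v\<close> in the basis \<open>v\<close>,
  \<open>f v\<close> are therefore the coefficients sought.\<close>

lemma commutant_nonscalar:
  assumes f: "Vector_Spaces.linear scale scale f" "\<nexists>c. f = scale c"
    and g: "Vector_Spaces.linear scale scale g" and fg: "f \<circ> g = g \<circ> f"
  obtains x y where "g = (\<lambda>v. x *s v + y *s f v)"
proof -
  interpret f: Vector_Spaces.linear scale scale f by (rule f(1))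
  interpret g: Vector_Spaces.linear scale scale g by (rule g)
  obtain v where "v \<noteq> f v" "independent {v, f v}"
    using cyclic_vector_if_nonscalar f by blast
  then have span: "w \<in> span {v, f v}" for w
    using span_independent_pair by simp
  obtain x y where gv: "g v = x *s v + y *s f v" using span[of "g v"] span_pair by blast
  have gf: "g (f w) = f (g w)" for w using fg by (metis comp_apply)
  have "g w = x *s w + y *s f w" for w
  proof -
    obtain s t where w: "w = s *s v + t *s f v" using span[of w] span_pair by blast
    show ?thesis unfolding w
      by (simp add: f.add f.scale g.add g.scale gf gv algebra_simps)
  qed
  then show ?thesis using that by blast
qed

text \<open>Images of basis vectors are columns while \<open>vector\<close> lists rows; hence
  \<open>p\<close>, \<open>q\<close> run down the first column.\<close>

lemma obtain_ordered_basis_pair: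
  fixes w1 w2 :: 'b
  assumes "w1 \<noteq> w2" "independent {w1, w2}"
  obtains b :: "2 \<Rightarrow> 'b" where "ordered_basis scale b"
    "\<And>f p q r s. f w1 = p *s w1 + q *s w2 \<Longrightarrow> f w2 = r *s w1 + s *s w2 \<Longrightarrow>
      matrix_of scale b f = vector [vector [p, r], vector [q, s]]"
proof -
  define b :: "2 \<Rightarrow> 'b" where "b i = (if i = 1 then w1 else w2)" for i
  have b: "b 1 = w1" "b 2 = w2" by (simp_all add: b_def)
  have range: "range b = {w1, w2}"
    using b by (auto simp: UNIV_2)
  have "inj b"
    using b assms by (auto simp: inj_on_def forall_2)
  then have ob: "ordered_basis scale b"
    unfolding ordered_basis_def range using assms span_independent_pair by simp
  have rep: "representation {w1, w2} (x *s w1 + y *s w2) w1 = x"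
    "representation {w1, w2} (x *s w1 + y *s w2) w2 = y" for x y
    using assms
    by (simp_all add: representation_add representation_scale representation_basis span_base span_scale)
  show ?thesis
  proof (rule that[OF ob])
    fix f p q r s assume "f w1 = p *s w1 + q *s w2" "f w2 = r *s w1 + s *s w2"
    then show "matrix_of scale b f = vector [vector [p, r], vector [q, s]]"
      by (simp add: matrix_of_def vec_eq_iff forall_2 range b rep)
  qed
qed

text \<open>The witness is the span of \<open>id\<close> and the projection \<open>P\<close> onto
  the line of \<open>a\<close> along \<open>b\<close>, that is, the diagonal matrices in this basis.
  The single vector \<open>a + b\<close> generates the plane: \<open>P\<close> sends it to
  \<open>a\<close>, and the difference is \<open>b\<close>. So a line serves as \<open>U\<close> for
  every \<open>r \<ge> 1\<close>.\<close>

lemma exists_commutative_spanning: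
  assumes "1 \<le> r"
  shows "\<exists>A. End_subspace scale A \<and> commutative A \<and> spanning scale r A \<and> End_dim scale A = 2"
proof -
  interpret E: vector_space "fun_scale scale"
    by (rule vector_space_fun_scale) unfold_locales
  obtain a b where ab: "a \<noteq> b" "independent {a, b}" "span {a, b} = UNIV"
    using obtain_basis_pair by blast
  define P where "P v = representation {a, b} v a *s a" for v
  have lin: "Vector_Spaces.linear scale scale P"
    by unfold_locales
      (simp_all add: P_def representation_add representation_scale ab scale_left_distrib)
  interpret P: Vector_Spaces.linear scale scale P by (rule lin)
  have Pa: "P a = a" and Pb: "P b = 0"
    using ab by (auto simp: P_def representation_basis)
  let ?A = "E.span {id, P}"
  have "End_subspace scale ?A"
    by (auto simp: End_subspace_def End_def mem_span_id_iff linear_combination_id lin)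
  moreover have "commutative ?A"
    by (auto simp: commutative_def mem_span_id_iff fun_eq_iff P.add P.scale algebra_simps)
  moreover have "spanning scale r ?A"
  proof -
    let ?X = "{f u | f u. f \<in> ?A \<and> u \<in> span {a + b}}"
    have "id (a + b) \<in> ?X" "P (a + b) \<in> ?X"
      using E.span_base span_base by blast+
    then have "a + b \<in> span ?X" "a \<in> span ?X"
      by (auto simp: P.add Pa Pb intro: span_base)
    then have "a \<in> span ?X" "b \<in> span ?X"
      using span_diff[of "a + b" ?X a] by simp_all
    then have "span {a, b} \<subseteq> span ?X" by (intro span_minimal) auto
    moreover have "dim (span {a + b}) \<le> r"
      using dim_le_card[of "span {a + b}" "{a + b}"] assms by simp
    ultimately show ?thesis
      unfolding spanning_def using ab by (intro exI[of _ "span {a + b}"]) auto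
  qed
  moreover have "id \<noteq> P \<and> E.independent {id, P}"
  proof (unfold E.independent_pair_iff, intro allI impI)
    fix x y assume "fun_scale scale x id + fun_scale scale y P = 0"
    then have e: "x *s v + y *s P v = 0" for v
      by (simp add: fun_scale_def fun_eq_iff)
    have "b \<noteq> 0" "a \<noteq> 0" using ab dependent_zero by auto
    \<comment> \<open>Evaluation at \<open>b\<close> removes the \<open>P\<close> term and gives
      \<open>x = 0\<close>; evaluation at \<open>a\<close> then gives \<open>y = 0\<close>.\<close>
    then show "x = 0 \<and> y = 0" using e[of a] e[of b] by (auto simp: Pa Pb)
  qed
  then have "End_dim scale ?A = 2"
    unfolding End_dim_def by (metis E.dim_span_eq_card_independent card_2_iff)
  ultimately show ?thesis by blast
qed

lemma End_dim_le_1_if_scalars: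
  assumes "\<And>f. f \<in> A \<Longrightarrow> \<exists>c. f = scale c"
  shows "End_dim scale A \<le> 1"
proof -
  interpret E: vector_space "fun_scale scale"
    by (rule vector_space_fun_scale) unfold_locales
  have "f \<in> E.span {id}" if "f \<in> A" for f
    using assms[OF that] by (auto simp: E.span_singleton fun_scale_def)
  then show ?thesis
    using E.dim_le_card[of A "{id}"] by (auto simp: End_dim_def)
qed

end

section \<open>Explicit matrix families and the splitting of quadratics\<close>

lemma diagonal_matrices_eq:
  "diagonal_matrices = {vector [vector [p, 0], vector [0, s]] | p s. True}"
proof (intro set_eqI iffI)
  fix M :: "'a::field^2^2" assume "M \<in> diagonal_matrices"
  then have "M = vector [vector [M$1$1, 0], vector [0, M$2$2]]"
    by (simp add: diagonal_matrices_def vec_eq_iff forall_2)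
  then show "M \<in> {vector [vector [p, 0], vector [0, s]] | p s. True}" by blast
qed (auto simp: diagonal_matrices_def forall_2)

lemma Id_plus_W_1_1_eq_vector:
  "Id_plus_W_1_1 = {vector [vector [p, r], vector [0, p]] | p r. True}"
proof (intro set_eqI iffI)
  fix M :: "'a::field^2^2" assume "M \<in> Id_plus_W_1_1"
  then have "M = vector [vector [M$1$1, M$1$2], vector [0, M$1$1]]"
    by (simp add: Id_plus_W_1_1_eq vec_eq_iff forall_2)
  then show "M \<in> {vector [vector [p, r], vector [0, p]] | p r. True}" by blast
qed (auto simp: Id_plus_W_1_1_eq)

text \<open>One root \<open>l\<close> of \<open>t^2 - q t - p\<close> suffices, since the other is
  then \<open>q - l\<close>. The signs fit a relation
  \<open>f (f v) = p *s v + q *s f v\<close>.\<close>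

lemma alg_closed_monic_quadratic_splits:
  fixes p q :: "'a::alg_closed_field"
  obtains l m where "q = l + m" "p = - (l * m)"
proof -
  have "\<exists>l. poly [:- p, - q, 1:] l = 0"
    by (intro alg_closed_imp_poly_has_root) simp
  then obtain l where "- p + l * (- q + l) = 0" by auto
  then have "p = - (l * (q - l))" by (simp add: algebra_simps add_eq_0_iff)
  then show ?thesis using that[of l "q - l"] by simp
qed

section \<open>Normal forms and classification over an algebraically closed field\<close>

locale alg_closed_plane = plane scale
  for scale :: "'k::alg_closed_field \<Rightarrow> 'v::ab_group_add \<Rightarrow> 'v" (infixr "*s" 75)
begin

text \<open>For a cyclic vector \<open>v\<close>, the product \<open>(f - l) (f - m)\<close> kills
  \<open>v\<close>. Hence \<open>(f - m) v\<close> and \<open>(f - l) v\<close> are eigenvectors for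
  \<open>l\<close> and \<open>m\<close>. They form a basis if \<open>l \<noteq> m\<close>; if
  \<open>l = m\<close>, then \<open>(f - l) v\<close> and \<open>v\<close> form a Jordan
  basis.\<close>

lemma nonscalar_normal_form:
  assumes "Vector_Spaces.linear scale scale f" and "\<nexists>c. f = scale c"
  obtains (diagonal) l m w1 w2 where "l \<noteq> m" "w1 \<noteq> w2" "independent {w1, w2}"
      "f w1 = l *s w1" "f w2 = m *s w2"
    | (jordan) l w1 w2 where "w1 \<noteq> w2" "independent {w1, w2}"
      "f w1 = l *s w1" "f w2 = w1 + l *s w2"
proof -
  interpret f: Vector_Spaces.linear scale scale f by (rule assms(1))
  obtain v where v: "v \<noteq> f v" "independent {v, f v}"
    using cyclic_vector_if_nonscalar assms by blast
  then have indep: "x = 0 \<and> y = 0" if "x *s v + y *s f v = 0" for x y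
    using independent_pair_iff[of v "f v"] that by blast
  obtain p q where "f (f v) = p *s v + q *s f v"
    using span_independent_pair[OF v] span_pair by blast
  moreover obtain l m where "q = l + m" "p = - (l * m)"
    using alg_closed_monic_quadratic_splits by blast
  ultimately have ff: "f (f v) = (- (l * m)) *s v + (l + m) *s f v" by simp
  have eig: "f (f v - m *s v) = l *s (f v - m *s v)" "f (f v - l *s v) = m *s (f v - l *s v)"
      by (simp_all add: f.diff f.scale ff algebra_simps)
  show ?thesis
  proof (cases "l = m")
    case False
    have "f v - m *s v \<noteq> f v - l *s v \<and> independent {f v - m *s v, f v - l *s v}"
    proof (unfold independent_pair_iff, intro allI impI)
      fix x y assume "x *s (f v - m *s v) + y *s (f v - l *s v) = 0"
      then have "(- (x * m + y * l)) *s v + (x + y) *s f v = 0"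
        by (simp add: algebra_simps)
      then have "- (x * m + y * l) = 0 \<and> x + y = 0" by (rule indep)
      then have "x * m + y * l = 0" and x: "x = - y"
        by (metis neg_equal_0_iff_equal, metis add_eq_0_iff2)
      then have "y * (l - m) = 0" by (simp add: algebra_simps)
      then show "x = 0 \<and> y = 0" using False x by simp
    qed
    then show ?thesis using diagonal False eig by blast
  next
    case True
    \<comment> \<open>The eigenvector comes first, so that the off-diagonal entry lands in the first
      row, as \<open>W_1_1\<close> requires.\<close>
    have "f v - l *s v \<noteq> v \<and> independent {f v - l *s v, v}"
    proof (unfold independent_pair_iff, intro allI impI)
      fix x y assume "x *s (f v - l *s v) + y *s v = 0"
      then have "(y - x * l) *s v + x *s f v = 0"
        by (simp add: algebra_simps)
      then have "y - x * l = 0 \<and> x = 0" by (rule indep)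
      then show "x = 0 \<and> y = 0" by simp
    qed
    moreover have "f (f v - l *s v) = l *s (f v - l *s v)" using eig True by simp
    moreover have "f v = (f v - l *s v) + l *s v" by simp
    ultimately show ?thesis using jordan by blast
  qed
qed

text \<open>In the basis of the normal form, the matrix of \<open>x + y f\<close> runs through the
  whole target family as \<open>x\<close> and \<open>y\<close> vary; surjectivity amounts to solving
  two linear equations for \<open>x\<close> and \<open>y\<close>.\<close>

lemma equivalent_to_if_generated:
  assumes "Vector_Spaces.linear scale scale f" "\<nexists>c. f = scale c"
    and A: "\<And>g. g \<in> A \<longleftrightarrow> (\<exists>x y. g = (\<lambda>v. x *s v + y *s f v))"
  shows "equivalent_to scale A diagonal_matrices \<or> equivalent_to scale A Id_plus_W_1_1"
  using assms(1,2)
proof (cases rule: nonscalar_normal_form)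
  case (diagonal l m w1 w2)
  obtain b :: "2 \<Rightarrow> 'v" where b: "ordered_basis scale b"
    "\<And>f p q r s. f w1 = p *s w1 + q *s w2 \<Longrightarrow> f w2 = r *s w1 + s *s w2 \<Longrightarrow>
      matrix_of scale b f = vector [vector [p, r], vector [q, s]]"
    using obtain_ordered_basis_pair[OF diagonal(2,3)] by blast
  have M: "matrix_of scale b (\<lambda>v. x *s v + y *s f v)
      = vector [vector [x + y * l, 0], vector [0, x + y * m]]" for x y
    by (rule b(2)) (simp_all add: diagonal algebra_simps)
  have "matrix_of scale b ` A = diagonal_matrices"
  proof (intro set_eqI iffI)
    fix N :: "'k^2^2" assume "N \<in> diagonal_matrices"
    then obtain p s where N: "N = vector [vector [p, 0], vector [0, s]]"
      by (auto simp: diagonal_matrices_eq)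
    \<comment> \<open>Solves \<open>x + y * l = p\<close> and \<open>x + y * m = s\<close> with
      \<open>x = p - y * l\<close>; the eigenvalues being distinct makes the quotient
      meaningful.\<close>
    define y where "y = (p - s) / (l - m)"
    have "y * (l - m) = p - s" using diagonal(1) by (simp add: y_def)
    then have "(p - y * l) + y * l = p" "(p - y * l) + y * m = s"
      by (simp_all add: algebra_simps)
    then have "N = matrix_of scale b (\<lambda>v. (p - y * l) *s v + y *s f v)"
      unfolding M N by simp
    then show "N \<in> matrix_of scale b ` A" using A by blast
  qed (use M in \<open>fastforce simp: A diagonal_matrices_eq\<close>)
  then show ?thesis using b(1) by (auto simp: equivalent_to_def)
next
  case (jordan l w1 w2)
  obtain b :: "2 \<Rightarrow> 'v" where b: "ordered_basis scale b"
    "\<And>f p q r s. f w1 = p *s w1 + q *s w2 \<Longrightarrow> f w2 = r *s w1 + s *s w2 \<Longrightarrow>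
      matrix_of scale b f = vector [vector [p, r], vector [q, s]]"
    using obtain_ordered_basis_pair[OF jordan(1,2)] by blast
  have M: "matrix_of scale b (\<lambda>v. x *s v + y *s f v)
      = vector [vector [x + y * l, y], vector [0, x + y * l]]" for x y
    by (rule b(2)) (simp_all add: jordan algebra_simps)
  have "matrix_of scale b ` A = Id_plus_W_1_1"
  proof (intro set_eqI iffI)
    fix N :: "'k^2^2" assume "N \<in> Id_plus_W_1_1"
    then obtain p r where N: "N = vector [vector [p, r], vector [0, p]]"
      by (auto simp: Id_plus_W_1_1_eq_vector)
    \<comment> \<open>The upper right entry of the matrix is \<open>y\<close>, forcing
      \<open>y = r\<close>; the diagonal then gives \<open>x = p - r * l\<close>.\<close>
    have "N = matrix_of scale b (\<lambda>v. (p - r * l) *s v + r *s f v)"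
      unfolding M N by simp
    then show "N \<in> matrix_of scale b ` A" using A by blast
  qed (use M in \<open>fastforce simp: A Id_plus_W_1_1_eq_vector\<close>)
  then show ?thesis using b(1) by (auto simp: equivalent_to_def)
qed

text \<open>Either \<open>A\<close> consists of scalars and has dimension at most \<open>1\<close>,
  or it contains a nonscalar \<open>f\<close> and lies in the commutant of \<open>f\<close>, which
  is spanned by \<open>id\<close> and \<open>f\<close>.\<close>

lemma commutative_End_subspace:
  assumes A: "End_subspace scale A" "commutative A"
  shows "End_dim scale A \<le> 2 \<and> (End_dim scale A = 2 \<longrightarrow>
    equivalent_to scale A diagonal_matrices \<or> equivalent_to scale A Id_plus_W_1_1)"
proof (cases "\<forall>f\<in>A. \<exists>c. f = scale c")
  case True
  then have "End_dim scale A \<le> 1" by (intro End_dim_le_1_if_scalars) blast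
  then show ?thesis by simp
next
  case False
  interpret E: vector_space "fun_scale scale"
    by (rule vector_space_fun_scale) unfold_locales
  obtain f where f: "f \<in> A" "\<nexists>c. f = scale c" using False by blast
  have lin: "Vector_Spaces.linear scale scale g" if "g \<in> A" for g
    using A that by (auto simp: End_subspace_def End_def)
  have sub: "A \<subseteq> E.span {id, f}"
  proof
    fix g assume g: "g \<in> A"
    then have "f \<circ> g = g \<circ> f" using A f by (auto simp: commutative_def)
    then show "g \<in> E.span {id, f}"
      using commutant_nonscalar[OF lin[OF f(1)] f(2) lin[OF g]] mem_span_id_iff by metis
  qed
  have card: "card {id, f} \<le> 2" by (simp add: card_insert_if)
  have "End_dim scale A \<le> 2"
    using E.dim_le_card[OF sub] card by (simp add: End_dim_def)
  moreover have "equivalent_to scale A diagonal_matrices \<or> equivalent_to scale A Id_plus_W_1_1"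
    if "End_dim scale A = 2"
  proof -
    \<comment> \<open>The dimension of \<open>A\<close> reaches the number of generators, so the
      inclusion \<open>sub\<close> is an equality.\<close>
    have "A = E.span {id, f}"
      using A(1) sub that card
      by (intro E.subspace_eq_span_if_card_le_dim) (auto simp: End_subspace_def End_dim_def)
    then show ?thesis
      using equivalent_to_if_generated[OF lin[OF f(1)] f(2)] mem_span_id_iff by blast
  qed
  ultimately show ?thesis by blast
qed

end

theorem theorem4p13:
  fixes sc :: "'k::{alg_closed_field, field_char_0} \<Rightarrow> 'v::ab_group_add \<Rightarrow> 'v"
    and r :: nat
  assumes "vector_space sc"
    and "vector_space.dim sc (UNIV :: 'v set) = 2"
    and "r = 1 \<or> r = 2"
  shows "(\<exists>A. End_subspace sc A \<and> commutative A \<and>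
              spanning sc r A \<and> End_dim sc A = 2) \<and>
         (\<forall>A. End_subspace sc A \<longrightarrow> commutative A \<longrightarrow>
              spanning sc r A \<longrightarrow>
              End_dim sc A \<le> 2 \<and>
              (End_dim sc A = 2 \<longrightarrow>
                equivalent_to sc A diagonal_matrices \<or>
                equivalent_to sc A Id_plus_W_1_1))"
proof -
  interpret vector_space sc by (rule assms(1))
  interpret alg_closed_plane sc
    by unfold_locales (rule assms(2))
  show ?thesis
    \<comment> \<open>Both admissible values of \<open>r\<close> satisfy \<open>1 \<le> r\<close>,
      so the same construction serves for each.\<close>
    using exists_commutative_spanning[of r] commutative_End_subspace assms(3) by auto
qed

end
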